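(* Let $k>0$, $q\ge 0$ and $a\in\mathbb{R}$ with $a^2+q^2>0$, and set $$x^*=\frac1k\bigl(a+\sqrt{a^2+kq}\bigr),\qquad \tau=\frac{1}{2\sqrt{a^2+kq}}.$$ Let $C>0$ be a given constant and let $\eta$ be a constant with $0<\eta<\frac{1}{k\tau}$. Let $d\ge 0$ and $d_\Delta>0$ satisfy $$-\frac1{k\tau}+\eta\le d-x^*\le C,\qquad -\frac1{k\tau}+\eta\le d_\Delta-x^*\le C .$$ Let $x(t;d)$ be the solution of $\frac{dx}{dt}+kx^2-2ax-q=0$, $x(0)=d$, and, for a time step $\Delta t>0$ with $1+2|a|\Delta t-kq\,\Delta t^2\neq 0$, let $(x_j(\Delta t;d_\Delta))_{j\in\mathbb{N}}$ be the sequence given by the scalar homographic scheme (see context) with $x_0(\Delta t;d_\Delta)=d_\Delta$. Then the approximate value $x_j(\Delta t;d_\Delta)$ is arbitrarily close to the exact value $x(j\Delta t;d)$ for each $j$ as $\Delta t\to0$ and $d_\Delta\to d$. More precisely: (i) If $a\neq 0$, then $$|x(j\Delta t;d)-x_j(\Delta t;d_\Delta)|\le A\,\bigl(\Delta t+|d-d_\Delta|\bigr)\qquad\text{for all } j\in\mathbb{N},\ 0<\Delta t\le B,$$ with constants $A>0$, $B>0$ depending on the data $k,a,q,\eta$ but independent of the time step $\Delta t$ and of the iteration $j$. (ii) If $a=0$, the scheme is second order accurate in the following sense: $$|x(j\Delta t;d)-x_j(\Delta t;d_\Delta)|\le A\,\bigl(\Delta t^2+|d-d_\Delta|\bigr)\qquad\text{for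 all } j\in\mathbb{N},\ 0<\Delta t\le B,$$ with constants $A$ and $B$ independent of the time step $\Delta t$ and of the iteration $j$.
   Context: Write $a=a^+-a^-$ with $a^+=\max(a,0)$, $a^-=\max(-a,0)$. The scalar homographic scheme with time step $\Delta t>0$ for the Riccati equation $\frac{dx}{dt}+kx^2-2ax-q=0$ is $$\frac{x_{j+1}-x_j}{\Delta t}+k\,x_jx_{j+1}-2a^+x_j+2a^-x_{j+1}-q=0,$$ equivalently $$x_{j+1}=\frac{(1+2a^+\Delta t)\,x_j+q\,\Delta t}{k\,\Delta t\,x_j+1+2a^-\Delta t}.$$
   Formalization: The constants A and B are allowed to depend on the given bound C as well as on k, a, q, η; independence of C fails (k=a=1, q=0, d=d_Δ=D, Δt=1/D, j=1 gives an error tending to 1/4 as D→∞). *)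

theory Defs
  imports "HOL-Analysis.Analysis"
begin

definition riccati_equilibrium :: "real \<Rightarrow> real \<Rightarrow> real \<Rightarrow> real" where
  "riccati_equilibrium k a q = (1 / k) * (a + sqrt (a\<^sup>2 + k * q))"

definition riccati_tau :: "real \<Rightarrow> real \<Rightarrow> real \<Rightarrow> real" where
  "riccati_tau k a q = 1 / (2 * sqrt (a\<^sup>2 + k * q))"

definition riccati_solution :: "real \<Rightarrow> real \<Rightarrow> real \<Rightarrow> real \<Rightarrow> (real \<Rightarrow> real) \<Rightarrow> bool" where
  "riccati_solution k a q d x \<longleftrightarrow>
     x 0 = d \<and>
     (\<forall>t\<ge>0. \<exists>x'. (x has_real_derivative x') (at t within {0..}) \<and>
        x' + k * (x t)\<^sup>2 - 2 * a * x t - q = 0)"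

definition admissible_datum :: "real \<Rightarrow> real \<Rightarrow> real \<Rightarrow> real \<Rightarrow> real \<Rightarrow> real \<Rightarrow> bool" where
  "admissible_datum k a q C \<eta> d \<longleftrightarrow>
     - (1 / (k * riccati_tau k a q)) + \<eta> \<le> d - riccati_equilibrium k a q \<and>
     d - riccati_equilibrium k a q \<le> C"

definition homographic_scheme :: "real \<Rightarrow> real \<Rightarrow> real \<Rightarrow> real \<Rightarrow> (nat \<Rightarrow> real) \<Rightarrow> bool" where
  "homographic_scheme k a q h y \<longleftrightarrow>
     (\<forall>j. (y (Suc j) - y j) / h + k * y j * y (Suc j)
        - 2 * max a 0 * y j + 2 * max (- a) 0 * y (Suc j) - q = 0)"

primrec homographic_seq :: "real \<Rightarrow> real \<Rightarrow> real \<Rightarrow> real \<Rightarrow> real \<Rightarrow> nat \<Rightarrow> real" where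
  "homographic_seq k a q h e 0 = e"
| "homographic_seq k a q h e (Suc j) =
     ((1 + 2 * max a 0 * h) * homographic_seq k a q h e j + q * h) /
     (k * h * homographic_seq k a q h e j + 1 + 2 * max (- a) 0 * h)"

lemma homographic_seq_pos:
  assumes "k > 0" "q \<ge> 0" "h > 0" "e > 0"
  shows "homographic_seq k a q h e j > 0"
proof (induction j)
  case (Suc j)
  then show ?case using assms
    by (simp, intro divide_pos_pos add_pos_nonneg mult_pos_pos add_pos_pos mult_nonneg_nonneg)
      simp_all
qed (use assms in simp)

lemma homographic_scheme_step:
  fixes u v :: real
  assumes "k > 0" "h > 0" "u > 0"
  shows "(v - u) / h + k * u * v - 2 * max a 0 * u + 2 * max (- a) 0 * v - q = 0 \<longleftrightarrow>
    v = ((1 + 2 * max a 0 * h) * u + q * h) / (k * h * u + 1 + 2 * max (- a) 0 * h)"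
proof -
  define P N where "P = max a 0" and "N = max (- a) 0"
  have "N \<ge> 0" by (simp add: N_def)
  then have D: "k * h * u + 1 + 2 * N * h > 0"
    using assms by (intro add_pos_nonneg add_pos_pos mult_pos_pos mult_nonneg_nonneg) auto
  have "(v - u) / h + k * u * v - 2 * P * u + 2 * N * v - q = 0 \<longleftrightarrow>
    v * (k * h * u + 1 + 2 * N * h) = (1 + 2 * P * h) * u + q * h"
    using assms by (auto simp: field_simps)
  also have "\<dots> \<longleftrightarrow> v = ((1 + 2 * P * h) * u + q * h) / (k * h * u + 1 + 2 * N * h)"
    using D by (simp add: eq_divide_eq)
  finally show ?thesis by (simp add: P_def N_def)
qed

text \<open>For positive initial data the explicit recursion is exactly the implicit scheme;
  no denominator vanishes.\<close>

lemma homographic_scheme_iff_seq: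
  assumes "k > 0" "q \<ge> 0" "h > 0" "e > 0"
  shows "homographic_scheme k a q h y \<and> y 0 = e \<longleftrightarrow> y = homographic_seq k a q h e"
proof
  assume y: "homographic_scheme k a q h y \<and> y 0 = e"
  have "y j = homographic_seq k a q h e j" for j
  proof (induction j)
    case (Suc j)
    have "y j > 0" using Suc homographic_seq_pos[OF assms] by simp
    moreover have "(y (Suc j) - y j) / h + k * y j * y (Suc j)
        - 2 * max a 0 * y j + 2 * max (- a) 0 * y (Suc j) - q = 0"
      using y unfolding homographic_scheme_def by blast
    ultimately show ?case
      using homographic_scheme_step[of k h "y j" "y (Suc j)" a q] assms Suc by simp
  qed (use y in simp)
  then show "y = homographic_seq k a q h e" by blast
next
  assume "y = homographic_seq k a q h e"
  then show "homographic_scheme k a q h y \<and> y 0 = e"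
    unfolding homographic_scheme_def
    using homographic_scheme_step[OF assms(1,3) homographic_seq_pos[OF assms]]
      homographic_seq.simps by blast
qed

end

theory Submission
  imports Defs
begin

text \<open>
  Let \<open>s = sqrt (a\<^sup>2 + k q)\<close> and let \<open>r = (a - s) / k\<close> be the unstable equilibrium, so that the
  stable one is \<open>r + 2 s / k\<close>. In the variable \<open>u = 1 / (x - r)\<close> the Riccati equation becomes the
  linear equation \<open>u' = k - 2 s u\<close>, and the scheme, which is a homography with the same two fixed
  points, becomes an affine recursion. Hence the deviation of \<open>u\<close> from \<open>k / (2 s)\<close> is multiplied by
  \<open>exp (- 2 s h)\<close> in the exact flow and by
  \<open>(1 + h (\<bar>a\<bar> - s)) / (1 + h (\<bar>a\<bar> + s))\<close> in the scheme. These factors differ by \<open>O(h\<^sup>2)\<close>, and by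
  \<open>O(h\<^sup>3)\<close> if \<open>a = 0\<close>; both stay below \<open>1 - s h\<close>, so the difference of their \<open>j\<close>-th powers loses
  just one order, uniformly in \<open>j\<close>.
\<close>

section \<open>Scalar estimates comparing the exact and the discrete multiplier\<close>

text \<open>One more power shrinks the accumulated difference by \<open>1 - c\<close> and adds at
  most \<open>\<bar>E - R\<bar>\<close>. The bound is the fixed point of this recursion, hence free
  of \<open>j\<close>.\<close>

lemma power_diff_le_contraction:
  fixes E R c :: real
  assumes "0 \<le> E" "E \<le> 1 - c" "0 \<le> R" "R \<le> 1 - c" "0 < c"
  shows "\<bar>E ^ j - R ^ j\<bar> \<le> \<bar>E - R\<bar> / c"
proof (induction j)
  case (Suc j)
  have "E ^ Suc j - R ^ Suc j = E * (E ^ j - R ^ j) + R ^ j * (E - R)"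
    by (simp add: algebra_simps)
  then have "\<bar>E ^ Suc j - R ^ Suc j\<bar> \<le> E * \<bar>E ^ j - R ^ j\<bar> + R ^ j * \<bar>E - R\<bar>"
    using abs_triangle_ineq[of "E * (E ^ j - R ^ j)" "R ^ j * (E - R)"] assms
    by (simp add: abs_mult)
  also have "\<dots> \<le> (1 - c) * (\<bar>E - R\<bar> / c) + 1 * \<bar>E - R\<bar>"
    using assms Suc.IH by (intro add_mono mult_mono) (auto intro: power_le_one)
  also have "\<dots> = \<bar>E - R\<bar> / c"
    using assms by (simp add: field_simps)
  finally show ?case .
qed (use assms in simp)

lemma exp_minus_le_inverse:
  fixes x :: real
  assumes "0 \<le> x"
  shows "exp (- x) \<le> 1 / (1 + x)"
  using exp_ge_add_one_self[of x] assms by (simp add: exp_minus field_simps)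

text \<open>With denominators cleared, the claim is that \<open>g\<close>, which vanishes at 0, is
  nonnegative at \<open>y\<close>. The sign of its derivative is the inequality
  \<open>exp (- (2 * t)) \<le> 1 / (1 + 2 * t)\<close>.\<close>

lemma one_minus_over_one_plus_le_exp:
  fixes y :: real
  assumes "0 \<le> y"
  shows "(1 - y) / (1 + y) \<le> exp (- (2 * y))"
proof -
  define g where "g t = (1 + t) * exp (- (2 * t)) - (1 - t)" for t :: real
  have "g 0 \<le> g y"
  proof (rule DERIV_nonneg_imp_nondecreasing[OF assms])
    fix t :: real
    assume t: "0 \<le> t" "t \<le> y"
    have "(g has_real_derivative 1 - (1 + 2 * t) * exp (- (2 * t))) (at t)"
      unfolding g_def by (auto intro!: derivative_eq_intros simp: algebra_simps)
    moreover have "0 \<le> 1 - (1 + 2 * t) * exp (- (2 * t))"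
      using exp_minus_le_inverse[of "2 * t"] t by (simp add: field_simps)
    ultimately show "\<exists>D. (g has_real_derivative D) (at t) \<and> 0 \<le> D" by blast
  qed
  then show ?thesis using assms by (simp add: g_def field_simps)
qed

text \<open>For \<open>a = 0\<close> and \<open>y = h * s\<close> the quotient is the multiplier of
  the scheme, the diagonal Pade approximant of the exponential. The quadratic Taylor bound for
  \<open>exp (2 * y)\<close> has a reciprocal that exceeds the quotient by an exactly cubic term;
  the previous lemma gives the other side.\<close>

lemma exp_minus_cayley_le_cube:
  fixes y :: real
  assumes "0 \<le> y"
  shows "\<bar>exp (- (2 * y)) - (1 - y) / (1 + y)\<bar> \<le> 2 * y ^ 3"
proof -
  have D: "1 \<le> 1 + 2 * y + 2 * y\<^sup>2" "1 \<le> (1 + 2 * y + 2 * y\<^sup>2) * (1 + y)"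
    using assms by (auto simp: algebra_simps)
  have "1 + 2 * y + 2 * y\<^sup>2 \<le> exp (2 * y)"
    using exp_lower_Taylor_quadratic[of "2 * y"] assms by (simp add: power2_eq_square)
  then have "exp (- (2 * y)) \<le> 1 / (1 + 2 * y + 2 * y\<^sup>2)"
    using D(1) by (simp add: exp_minus field_simps)
  also have "\<dots> = (1 - y) / (1 + y) + 2 * y ^ 3 / ((1 + 2 * y + 2 * y\<^sup>2) * (1 + y))"
  proof -
    have "1 + y = (1 - y) * (1 + 2 * y + 2 * y\<^sup>2) + 2 * y ^ 3"
      by (simp add: algebra_simps power2_eq_square power3_eq_cube)
    moreover have "1 + 2 * y + 2 * y\<^sup>2 \<noteq> 0" "1 + y \<noteq> 0" using D(1) assms by linarith+
    ultimately show ?thesis by (simp add: divide_simps)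
  qed
  also have "2 * y ^ 3 / ((1 + 2 * y + 2 * y\<^sup>2) * (1 + y)) \<le> 2 * y ^ 3 / 1"
    using D assms by (intro divide_left_mono) auto
  finally show ?thesis
    using one_minus_over_one_plus_le_exp[OF assms] by simp
qed

text \<open>Both numbers are \<open>1 - 2 * s * h\<close> plus a nonnegative remainder, at most
  \<open>(2 * s * h)\<^sup>2\<close> for the exponential and
  \<open>2 * s * (p + s) * h\<^sup>2\<close> for the quotient. The parameter \<open>p\<close> stands
  for the absolute value of \<open>a\<close>.\<close>

lemma exp_minus_multiplier_le_square:
  fixes s p h :: real
  assumes "0 < s" "0 \<le> p" "0 < h"
  shows "\<bar>exp (- (2 * s * h)) - (1 + h * (p - s)) / (1 + h * (p + s))\<bar>
    \<le> (4 * s\<^sup>2 + 2 * s * (p + s)) * h\<^sup>2"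
proof -
  have pos: "0 < 1 + 2 * s * h" using assms by (intro add_pos_pos) auto
  then have "1 / (1 + 2 * s * h) = 1 - 2 * s * h + (2 * s * h)\<^sup>2 / (1 + 2 * s * h)"
    by (simp add: field_simps power2_eq_square)
  also have "(2 * s * h)\<^sup>2 / (1 + 2 * s * h) \<le> (2 * s * h)\<^sup>2 / 1"
    using assms pos by (intro divide_left_mono) auto
  finally have E: "exp (- (2 * s * h)) \<le> 1 - 2 * s * h + (2 * s * h)\<^sup>2"
    using exp_minus_le_inverse[of "2 * s * h"] assms by simp
  have E': "1 - 2 * s * h \<le> exp (- (2 * s * h))"
    using exp_ge_add_one_self[of "- (2 * s * h)"] by simp
  have D: "1 \<le> 1 + h * (p + s)" using assms by simp
  have R: "(1 + h * (p - s)) / (1 + h * (p + s))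
      = 1 - 2 * s * h + 2 * s * (p + s) * h\<^sup>2 / (1 + h * (p + s))"
    using D by (simp add: add_divide_distrib[symmetric] divide_simps)
      (simp add: algebra_simps power2_eq_square)
  have "2 * s * (p + s) * h\<^sup>2 / (1 + h * (p + s)) \<le> 2 * s * (p + s) * h\<^sup>2 / 1"
    using assms(1-3) D by (intro divide_left_mono) (auto simp: add_pos_nonneg)
  moreover have "0 \<le> 2 * s * (p + s) * h\<^sup>2 / (1 + h * (p + s))"
    using assms D by (intro divide_nonneg_nonneg) auto
  moreover have "0 \<le> (2 * s * h)\<^sup>2" "0 \<le> 2 * s * (p + s) * h\<^sup>2"
    using assms by auto
  moreover have "(4 * s\<^sup>2 + 2 * s * (p + s)) * h\<^sup>2 = (2 * s * h)\<^sup>2 + 2 * s * (p + s) * h\<^sup>2"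
    by (simp add: algebra_simps power2_eq_square)
  ultimately show ?thesis using E E' R by (simp add: abs_le_iff)
qed

text \<open>The contraction lemma applies with \<open>c = h * s\<close>, so the division by
  \<open>c\<close> costs exactly one factor \<open>h\<close>. The step restriction places both
  multipliers between 0 and \<open>1 - h * s\<close>.\<close>

lemma multiplier_powers_close:
  fixes s p h M :: real
  assumes "0 < s" "0 \<le> p" "0 < h" "h * (2 * s + p) \<le> 1"
    and "\<bar>exp (- (2 * s * h)) - (1 + h * (p - s)) / (1 + h * (p + s))\<bar> \<le> M * h * h ^ n"
  shows "\<bar>exp (- (2 * s * h)) ^ j - ((1 + h * (p - s)) / (1 + h * (p + s))) ^ j\<bar> \<le> M / s * h ^ n"
proof -
  let ?E = "exp (- (2 * s * h))" and ?R = "(1 + h * (p - s)) / (1 + h * (p + s))"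
  have hs: "0 < h * s" "0 \<le> h * p" using assms by auto
  have le: "2 * (h * s) + h * p \<le> 1" using assms by (simp add: algebra_simps)
  have D: "1 \<le> 1 + h * (p + s)" "1 + h * (p + s) \<le> 2"
    using le hs by (auto simp: algebra_simps)
  have "?E \<le> 1 / (1 + 2 * s * h)"
    using exp_minus_le_inverse[of "2 * s * h"] assms by simp
  also have "\<dots> \<le> 1 - h * s"
  proof -
    have "2 * (h * s) * (h * s) \<le> 1 * (h * s)"
      using hs le by (intro mult_right_mono) auto
    then have "1 \<le> (1 - h * s) * (1 + 2 * s * h)"
      by (simp add: algebra_simps)
    moreover have "0 < 1 + 2 * s * h" using assms by (intro add_pos_pos) auto
    ultimately show ?thesis by (simp only: pos_divide_le_eq)
  qed
  finally have E: "?E \<le> 1 - h * s" .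
  \<comment> \<open>The quotient is \<open>1 - 2 * h * s / (1 + h * (p + s))\<close>, so a
    denominator of at most 2 gives the bound.\<close>
  have "h * s * (1 + h * (p + s)) \<le> h * s * 2"
    using hs D by (intro mult_left_mono) auto
  then have R: "?R \<le> 1 - h * s"
    using D by (simp add: divide_le_eq) (simp add: algebra_simps)
  have R0: "0 \<le> ?R"
    using le hs D by (intro divide_nonneg_nonneg) (auto simp: algebra_simps)
  have "\<bar>?E ^ j - ?R ^ j\<bar> \<le> \<bar>?E - ?R\<bar> / (h * s)"
    by (rule power_diff_le_contraction) (use E R R0 hs in auto)
  also have "\<dots> \<le> M * h * h ^ n / (h * s)"
    using assms hs by (intro divide_right_mono) auto
  also have "\<dots> = M / s * h ^ n" using assms by simp
  finally show ?thesis .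
qed

section \<open>Closed form of the exact solution\<close>

text \<open>A Gronwall argument: if \<open>K\<close> bounds the absolute value of \<open>c\<close>,
  then \<open>F\<^sup>2\<close> damped by \<open>exp (- (2 * K * t))\<close> is nonincreasing,
  nonnegative and initially 0.\<close>

lemma linear_ode_zero:
  fixes F c :: "real \<Rightarrow> real"
  assumes "0 \<le> T" "F 0 = 0" "continuous_on {0..T} c"
    and F: "\<And>t. 0 \<le> t \<Longrightarrow> t \<le> T \<Longrightarrow> (F has_real_derivative c t * F t) (at t within {0..})"
  shows "F T = 0"
proof -
  have "compact (c ` {0..T})"
    using assms by (intro compact_continuous_image) auto
  then obtain K where K: "\<And>t. t \<in> {0..T} \<Longrightarrow> \<bar>c t\<bar> \<le> K"
    using compact_imp_bounded bounded_iff by (metis image_eqI real_norm_def)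
  define G where "G t = (F t)\<^sup>2 * exp (- (2 * K * t))" for t
  have G: "(G has_real_derivative 2 * (c t - K) * (F t)\<^sup>2 * exp (- (2 * K * t)))
      (at t within {0..})" if "0 \<le> t" "t \<le> T" for t
    unfolding G_def using that
    by (auto intro!: derivative_eq_intros F simp: algebra_simps power2_eq_square)
  have "G T \<le> G 0"
  proof (rule DERIV_nonpos_imp_decreasing_open[OF assms(1)])
    fix t :: real assume t: "0 < t" "t < T"
    then have "at t within {0..} = at t" by (intro at_within_interior) auto
    moreover have "2 * (c t - K) * (F t)\<^sup>2 * exp (- (2 * K * t)) \<le> 0"
      using K[of t] t by (intro mult_nonpos_nonneg[OF mult_nonpos_nonneg]) auto
    ultimately show "\<exists>y. DERIV G t :> y \<and> y \<le> 0" using G[of t] t by auto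
  next
    show "continuous_on {0..T} G"
      unfolding continuous_on_eq_continuous_within
      using G by (metis DERIV_subset DERIV_isCont atLeastAtMost_iff has_field_derivative_imp_has_derivative
        has_derivative_continuous atLeast_iff subsetI)
  qed
  then have "(F T)\<^sup>2 * exp (- (2 * K * T)) \<le> 0" using assms by (simp add: G_def)
  then show ?thesis by (simp add: mult_le_0_iff)
qed

text \<open>Dividing by \<open>x - r\<close> would presuppose that \<open>x\<close> never meets the
  unstable equilibrium. Instead the candidate reciprocal \<open>U\<close> is defined by its formula,
  and the defect \<open>F = 1 - U * (x - r)\<close> solves a homogeneous linear equation with zero
  initial value.\<close>

lemma riccati_solution_explicit:
  fixes k a q s d :: real
  assumes "0 < k" "0 < s" "s\<^sup>2 = a\<^sup>2 + k * q"
    and "(a - s) / k < d" "riccati_solution k a q d x" "0 \<le> T"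
  shows "1 / (x T - (a - s) / k)
    = k / (2 * s) + (1 / (d - (a - s) / k) - k / (2 * s)) * exp (- (2 * s * T))"
proof -
  define r where "r = (a - s) / k"
  define w where "w = 1 / (d - r) - k / (2 * s)"
  define U where "U t = k / (2 * s) + w * exp (- (2 * s * t))" for t
  define F where "F t = 1 - U t * (x t - r)" for t
  have x: "(x has_real_derivative q + 2 * a * x t - k * (x t)\<^sup>2) (at t within {0..})"
    if t: "0 \<le> t" for t
  proof -
    obtain x' where x': "(x has_real_derivative x') (at t within {0..})"
      "x' + k * (x t)\<^sup>2 - 2 * a * x t - q = 0"
      using assms(5) t unfolding riccati_solution_def by blast
    have "x' = q + 2 * a * x t - k * (x t)\<^sup>2" using x'(2) by simp
    then show ?thesis using x'(1) by simp
  qed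
  have factor: "q + 2 * a * v - k * v\<^sup>2 = 2 * s * (v - r) - k * (v - r)\<^sup>2" for v
  proof -
    \<comment> \<open>Multiplying by \<open>k\<close> lets \<open>q\<close> and \<open>r\<close>
      enter only through \<open>k * q = s\<^sup>2 - a\<^sup>2\<close> and
      \<open>k * r = a - s\<close>.\<close>
    have "k * q = s\<^sup>2 - a\<^sup>2" using assms by simp
    then have "k * (q + 2 * a * v - k * v\<^sup>2) = s\<^sup>2 - a\<^sup>2 + 2 * a * (k * v) - (k * v)\<^sup>2"
      by (simp add: algebra_simps power2_eq_square)
    also have "\<dots> = 2 * s * (k * v - (a - s)) - (k * v - (a - s))\<^sup>2"
      by (simp add: algebra_simps power2_eq_square)
    also have "a - s = k * r"
      using assms by (simp add: r_def)
    also have "2 * s * (k * v - k * r) - (k * v - k * r)\<^sup>2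
        = k * (2 * s * (v - r) - k * (v - r)\<^sup>2)"
      by (simp add: algebra_simps power2_eq_square)
    finally show ?thesis using assms by simp
  qed
  have U: "(U has_real_derivative k - 2 * s * U t) (at t within {0..})" for t
    unfolding U_def using assms
    by (auto intro!: derivative_eq_intros simp: algebra_simps)
  have "F T = 0"
  proof (rule linear_ode_zero[where F = F and T = T and c = "\<lambda>t. - k * (x t - r)"])
    show "F 0 = 0"
      using assms by (simp add: F_def U_def w_def r_def riccati_solution_def)
    show "continuous_on {0..T} (\<lambda>t. - k * (x t - r))"
    proof -
      have "continuous_on {0..} x"
        unfolding continuous_on_eq_continuous_within
        using x by (metis has_derivative_continuous has_field_derivative_imp_has_derivative atLeast_iff)
      then have "continuous_on {0..T} x" by (rule continuous_on_subset) auto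
      then show ?thesis by (intro continuous_intros)
    qed
    fix t assume t: "0 \<le> t" "t \<le> T"
    have "(F has_real_derivative
        - ((k - 2 * s * U t) * (x t - r) + (q + 2 * a * x t - k * (x t)\<^sup>2) * U t))
        (at t within {0..})"
      unfolding F_def using t by (auto intro!: derivative_eq_intros U x)
    then show "(F has_real_derivative - k * (x t - r) * F t) (at t within {0..})"
      unfolding factor by (simp add: F_def algebra_simps power2_eq_square)
  qed (use assms in auto)
  \<comment> \<open>A product equal to 1 excludes \<open>x T = r\<close>, so the reciprocal below is
    a genuine one.\<close>
  then have "U T * (x T - r) = 1" by (simp add: F_def)
  then have "1 / (x T - r) = U T"
    by (metis mult_zero_right nonzero_eq_divide_eq zero_neq_one)
  then show ?thesis by (simp add: U_def w_def r_def)
qed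

section \<open>Closed form of the scheme\<close>

text \<open>Since \<open>r\<close> is a fixed point, the homography in \<open>z = y - r\<close> has
  no constant term in its numerator, and passing to \<open>1 / z\<close> makes it affine. The
  condition \<open>h * s < 1\<close> keeps \<open>\<alpha>\<close> positive, so the denominators are
  positive and the iterates stay above \<open>r\<close>.\<close>

lemma homographic_seq_explicit:
  fixes k a q s h e :: real
  assumes "0 < k" "0 < s" "s\<^sup>2 = a\<^sup>2 + k * q" "0 < h" "h * s < 1" "(a - s) / k < e"
  shows "(a - s) / k < homographic_seq k a q h e j"
    and "1 / (homographic_seq k a q h e j - (a - s) / k)
      = k / (2 * s) + (1 / (e - (a - s) / k) - k / (2 * s))
          * ((1 + h * (\<bar>a\<bar> - s)) / (1 + h * (\<bar>a\<bar> + s))) ^ j"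
proof -
  define r where "r = (a - s) / k"
  define \<alpha> where "\<alpha> = 1 + h * (\<bar>a\<bar> - s)"
  define \<beta> where "\<beta> = 1 + h * (\<bar>a\<bar> + s)"
  define y where "y = homographic_seq k a q h e"
  have "0 \<le> h * \<bar>a\<bar>" using assms by simp
  moreover have "0 < h * s" using assms by simp
  ultimately have \<alpha>: "0 < \<alpha>" and \<beta>: "0 < \<beta>"
    using assms(5) unfolding \<alpha>_def \<beta>_def distrib_left right_diff_distrib by linarith+
  have kr: "k * r = a - s" using assms by (simp add: r_def)
  have step: "y (Suc j) - r = \<beta> * (y j - r) / (k * h * (y j - r) + \<alpha>)"
    if "r < y j" for j
  proof -
    \<comment> \<open>Both signs of \<open>a\<close> are covered by
      \<open>a + 2 * max (- a) 0 = \<bar>a\<bar>\<close>.\<close>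
    have den: "k * h * y j + 1 + 2 * max (- a) 0 * h = k * h * (y j - r) + \<alpha>"
    proof -
      have "k * h * (y j - r) = k * h * y j - h * (k * r)" by (simp add: algebra_simps)
      then show ?thesis unfolding kr \<alpha>_def by (simp add: max_def abs_if algebra_simps)
    qed
    have pos: "0 < k * h * (y j - r) + \<alpha>"
      using assms \<alpha> that by (intro add_pos_pos mult_pos_pos) auto
    have "k * ((1 + 2 * max a 0 * h) * y j + q * h - r * (k * h * (y j - r) + \<alpha>))
      = k * (\<beta> * (y j - r))"
    proof -
      have "k * ((1 + 2 * max a 0 * h) * y j + q * h - r * (k * h * (y j - r) + \<alpha>))
        = (1 + 2 * max a 0 * h) * (k * y j) + k * q * h
          - k * r * (h * (k * y j - k * r) + \<alpha>)"
        by (simp add: algebra_simps)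
      also have "k * q = s\<^sup>2 - a\<^sup>2" using assms by simp
      also have "(1 + 2 * max a 0 * h) * (k * y j) + (s\<^sup>2 - a\<^sup>2) * h
          - k * r * (h * (k * y j - k * r) + \<alpha>) = \<beta> * (k * y j - k * r)"
        unfolding kr \<alpha>_def \<beta>_def
        by (cases "a \<ge> 0") (simp_all add: max_def abs_if algebra_simps power2_eq_square)
      finally show ?thesis by (simp add: algebra_simps)
    qed
    then have "(1 + 2 * max a 0 * h) * y j + q * h - r * (k * h * (y j - r) + \<alpha>)
      = \<beta> * (y j - r)" using assms by simp
    then show ?thesis
      unfolding y_def homographic_seq.simps den[unfolded y_def]
      using pos by (simp add: y_def field_simps)
  qed
  have *: "r < y j" for j
  proof (induction j)
    case (Suc j)
    have "0 < y (Suc j) - r"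
      unfolding step[OF Suc] using assms \<alpha> \<beta> Suc
      by (intro divide_pos_pos mult_pos_pos add_pos_pos) auto
    then show ?case by simp
  qed (use assms in \<open>simp add: y_def r_def\<close>)
  then show "(a - s) / k < homographic_seq k a q h e j" by (simp add: y_def r_def)
  have lin: "1 / (y (Suc j) - r) = k * h / \<beta> + \<alpha> / \<beta> * (1 / (y j - r))" for j
    unfolding step[OF *] using *[of j] \<alpha> \<beta> by (simp add: field_simps)
  \<comment> \<open>The fixed point is \<open>k * h / (\<beta> - \<alpha>)\<close>, and
    \<open>\<beta> - \<alpha> = 2 * h * s\<close>. It is the equilibrium of the linear equation for
    the exact reciprocal too.\<close>
  have fixpoint: "k * h / \<beta> + \<alpha> / \<beta> * (k / (2 * s)) = k / (2 * s)"
    using assms \<beta> by (simp add: field_simps) (simp add: \<alpha>_def \<beta>_def algebra_simps)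
  have "1 / (y j - r) = k / (2 * s) + (1 / (e - r) - k / (2 * s)) * (\<alpha> / \<beta>) ^ j"
  proof (induction j)
    case (Suc j)
    have "1 / (y (Suc j) - r) = (k * h / \<beta> + \<alpha> / \<beta> * (k / (2 * s)))
        + (1 / (e - r) - k / (2 * s)) * (\<alpha> / \<beta>) ^ Suc j"
      unfolding lin Suc by (simp only: power_Suc) algebra
    then show ?case unfolding fixpoint .
  qed (simp add: y_def)
  then show "1 / (homographic_seq k a q h e j - (a - s) / k)
      = k / (2 * s) + (1 / (e - (a - s) / k) - k / (2 * s))
          * ((1 + h * (\<bar>a\<bar> - s)) / (1 + h * (\<bar>a\<bar> + s))) ^ j"
    by (simp add: y_def r_def \<alpha>_def \<beta>_def)
qed

section \<open>From the reciprocal variable back to the error\<close>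

lemma inverse_difference_bound:
  fixes u v m :: real
  assumes "0 < m" "1 / m \<le> u" "1 / m \<le> v"
  shows "\<bar>1 / u - 1 / v\<bar> \<le> m\<^sup>2 * \<bar>u - v\<bar>"
proof -
  have pos: "0 < u" "0 < v" using assms by (smt (verit) zero_less_divide_1_iff)+
  then have "1 / u \<le> m" "1 / v \<le> m" using assms by (auto simp: field_simps)
  then have "(1 / u) * (1 / v) \<le> m * m"
    using pos assms by (intro mult_mono) auto
  moreover have "\<bar>1 / u - 1 / v\<bar> = (1 / u) * (1 / v) * \<bar>u - v\<bar>"
  proof -
    have "1 / u - 1 / v = (1 / u) * (1 / v) * (v - u)" using pos by (simp add: field_simps)
    then show ?thesis using pos by (simp add: abs_mult abs_minus_commute)
  qed
  ultimately show ?thesis by (simp only: power2_eq_square mult_right_mono abs_ge_zero)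
qed

text \<open>Both reciprocals interpolate between their initial value and the equilibrium value with
  weight \<open>E ^ j\<close> or \<open>R ^ j\<close>; this keeps them away from 0 for all
  \<open>j\<close>.\<close>

lemma convex_combination_ge:
  fixes b c m w :: real
  assumes "m \<le> b" "m \<le> c" "0 \<le> w" "w \<le> 1"
  shows "m \<le> b + (c - b) * w"
proof -
  have "(1 - w) * m + w * m \<le> (1 - w) * b + w * c"
    using assms by (intro add_mono mult_left_mono) auto
  then show ?thesis by (simp add: algebra_simps)
qed

text \<open>With \<open>L\<close> the distance between the equilibria, the data satisfy
  \<open>\<eta> \<le> d - r \<le> L + C\<close>, and likewise for \<open>e\<close>. The lower end
  makes the initial reciprocals bounded and Lipschitz in the datum; the upper end gives
  \<open>u\<close> and \<open>v\<close> at least \<open>1 / (L + C)\<close>, whence the Lipschitz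
  factor \<open>(L + C)\<^sup>2\<close> for inverting back.\<close>

lemma homographic_error_bound:
  fixes k q a s C \<eta> M h d e :: real
  assumes "0 < k" "0 < s" "s\<^sup>2 = a\<^sup>2 + k * q" "0 < C" "0 < \<eta>" "\<eta> < 2 * s / k"
    and d: "(a - s) / k + \<eta> \<le> d" "d \<le> (a + s) / k + C"
    and e: "(a - s) / k + \<eta> \<le> e" "e \<le> (a + s) / k + C"
    and "riccati_solution k a q d x" "0 < h" "h * (2 * s + \<bar>a\<bar>) \<le> 1"
    and M: "\<bar>exp (- (2 * s * h)) - (1 + h * (\<bar>a\<bar> - s)) / (1 + h * (\<bar>a\<bar> + s))\<bar> \<le> M * h * h ^ n"
  shows "\<bar>x (real j * h) - homographic_seq k a q h e j\<bar>
    \<le> (2 * s / k + C)\<^sup>2 * (M / (s * \<eta>) * h ^ n + \<bar>d - e\<bar> / \<eta>\<^sup>2)"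
proof -
  define r where "r = (a - s) / k"
  define L where "L = 2 * s / k"
  define E where "E = exp (- (2 * s * h))"
  define R where "R = (1 + h * (\<bar>a\<bar> - s)) / (1 + h * (\<bar>a\<bar> + s))"
  define u where "u = 1 / L + (1 / (d - r) - 1 / L) * E ^ j"
  define v where "v = 1 / L + (1 / (e - r) - 1 / L) * R ^ j"
  have L: "0 < L" "\<eta> < L" using assms by (auto simp: L_def)
  have rL: "(a + s) / k = r + L" using assms by (simp add: r_def L_def field_simps)
  have dr: "\<eta> \<le> d - r" "d - r \<le> L + C" and er: "\<eta> \<le> e - r" "e - r \<le> L + C"
    using d e rL by (auto simp: r_def)
  have "0 < h * s" "0 \<le> h * \<bar>a\<bar>" "2 * (h * s) + h * \<bar>a\<bar> \<le> 1"
    using assms by (auto simp: algebra_simps)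
  then have hs: "h * s < 1" and R: "0 \<le> R" "R \<le> 1"
    unfolding R_def by (auto intro!: divide_nonneg_nonneg simp: algebra_simps)
  have E: "0 \<le> E" "E \<le> 1" using assms by (auto simp: E_def)
  have "E ^ j = exp (- (2 * s * (real j * h)))"
    unfolding E_def by (simp flip: exp_of_nat_mult add: algebra_simps)
  then have "1 / (x (real j * h) - r) = u"
    using riccati_solution_explicit[of k s a q d x "real j * h"] assms
    by (simp add: u_def L_def r_def)
  then have xu: "x (real j * h) - r = 1 / u" by auto
  have "1 / (homographic_seq k a q h e j - r) = v"
    using homographic_seq_explicit(2)[of k s a q h e j] assms hs
    by (simp add: v_def L_def r_def R_def)
  then have yv: "homographic_seq k a q h e j - r = 1 / v" by auto
  have u_ge: "1 / (L + C) \<le> u" unfolding u_def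
    using dr L assms E by (intro convex_combination_ge divide_left_mono power_le_one) auto
  have v_ge: "1 / (L + C) \<le> v" unfolding v_def
    using er L assms R by (intro convex_combination_ge divide_left_mono power_le_one) auto
  have w: "\<bar>1 / (d - r) - 1 / L\<bar> \<le> 1 / \<eta>"
  proof -
    have "1 / (d - r) \<le> 1 / \<eta>" "1 / L \<le> 1 / \<eta>"
      using dr L assms by (auto intro!: divide_left_mono)
    moreover have "0 \<le> 1 / (d - r)" "0 \<le> 1 / L" using dr L assms by auto
    ultimately show ?thesis by linarith
  qed
  have EM: "\<bar>E ^ j - R ^ j\<bar> \<le> M / s * h ^ n"
    unfolding E_def R_def using assms by (intro multiplier_powers_close) auto
  have de: "\<bar>1 / (d - r) - 1 / (e - r)\<bar> \<le> \<bar>d - e\<bar> / \<eta>\<^sup>2"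
  proof -
    have "1 / (d - r) - 1 / (e - r) = (e - d) / ((d - r) * (e - r))"
      using dr er assms by (simp add: field_simps)
    then have "\<bar>1 / (d - r) - 1 / (e - r)\<bar> = \<bar>d - e\<bar> / ((d - r) * (e - r))"
      using dr er assms by (simp add: abs_mult abs_minus_commute)
    also have "\<dots> \<le> \<bar>d - e\<bar> / (\<eta> * \<eta>)"
      using dr er assms by (intro divide_left_mono mult_mono) auto
    finally show ?thesis by (simp add: power2_eq_square)
  qed
  \<comment> \<open>The first term is the discretization error for the datum \<open>d\<close>; the
    second is the change of datum, propagated by the scheme.\<close>
  have "u - v = (1 / (d - r) - 1 / L) * (E ^ j - R ^ j) + (1 / (d - r) - 1 / (e - r)) * R ^ j"
    by (simp add: u_def v_def algebra_simps)
  then have "\<bar>u - v\<bar> \<le> \<bar>1 / (d - r) - 1 / L\<bar> * \<bar>E ^ j - R ^ j\<bar>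
      + \<bar>1 / (d - r) - 1 / (e - r)\<bar> * \<bar>R ^ j\<bar>"
    by (metis abs_mult abs_triangle_ineq)
  also have "\<dots> \<le> 1 / \<eta> * (M / s * h ^ n) + \<bar>d - e\<bar> / \<eta>\<^sup>2 * 1"
    using w EM de R assms by (intro add_mono mult_mono) (auto intro: power_le_one)
  finally have uv: "\<bar>u - v\<bar> \<le> M / (s * \<eta>) * h ^ n + \<bar>d - e\<bar> / \<eta>\<^sup>2"
    by (simp add: mult.commute)
  have "\<bar>x (real j * h) - homographic_seq k a q h e j\<bar> = \<bar>1 / u - 1 / v\<bar>"
    using xu yv by linarith
  also have "\<dots> \<le> (L + C)\<^sup>2 * \<bar>u - v\<bar>"
    using u_ge v_ge L assms by (intro inverse_difference_bound) auto
  also have "\<dots> \<le> (L + C)\<^sup>2 * (M / (s * \<eta>) * h ^ n + \<bar>d - e\<bar> / \<eta>\<^sup>2)"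
    using uv by (intro mult_left_mono) auto
  finally show ?thesis by (simp add: L_def)
qed

section \<open>Uniform constants and the theorem\<close>

text \<open>The exponent \<open>n\<close> treats both orders at once: \<open>n = 1\<close> for every
  \<open>a\<close>, \<open>n = 2\<close> for \<open>a = 0\<close>. The constants are chosen before
  the data, the step and the index.\<close>

lemma homographic_uniform_error:
  fixes k q a C \<eta> :: real
  assumes "k > 0" "q \<ge> 0" "a\<^sup>2 + q\<^sup>2 > 0" "C > 0" "0 < \<eta>" "\<eta> < 1 / (k * riccati_tau k a q)"
    and n: "n = 1 \<or> a = 0 \<and> n = 2"
  shows "\<exists>A>0. \<exists>B>0. \<forall>d e x h j. admissible_datum k a q C \<eta> d \<and> admissible_datum k a q C \<eta> e \<and>
    riccati_solution k a q d x \<and> 0 < h \<and> h \<le> B \<longrightarrow>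
    \<bar>x (real j * h) - homographic_seq k a q h e j\<bar> \<le> A * (h ^ n + \<bar>d - e\<bar>)"
proof -
  define s where "s = sqrt (a\<^sup>2 + k * q)"
  have "0 < a\<^sup>2 + k * q"
    using assms by (cases "a = 0") (auto simp: add_pos_nonneg)
  then have s: "0 < s" "s\<^sup>2 = a\<^sup>2 + k * q" by (auto simp: s_def)
  have tau: "1 / (k * riccati_tau k a q) = 2 * s / k"
    using s by (simp add: riccati_tau_def s_def[symmetric])
  have eq: "riccati_equilibrium k a q = (a + s) / k"
    by (simp add: riccati_equilibrium_def s_def[symmetric])
  \<comment> \<open>The stable equilibrium minus \<open>2 * s / k\<close> is the unstable one, so
    admissible data lie at least \<open>\<eta>\<close> above the latter.\<close>
  have adm: "(a - s) / k + \<eta> \<le> d \<and> d \<le> (a + s) / k + C" if "admissible_datum k a q C \<eta> d" for d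
    using that assms(1) unfolding admissible_datum_def tau eq
    by (auto simp: diff_divide_distrib add_divide_distrib)
  obtain M where M: "0 < M" "\<And>h. 0 < h \<Longrightarrow>
    \<bar>exp (- (2 * s * h)) - (1 + h * (\<bar>a\<bar> - s)) / (1 + h * (\<bar>a\<bar> + s))\<bar> \<le> M * h * h ^ n"
  proof (cases "n = 1")
    case True
    have "0 < 4 * s\<^sup>2 + 2 * s * (\<bar>a\<bar> + s)" using s(1)
      by (intro add_pos_nonneg mult_nonneg_nonneg) auto
    moreover have "\<bar>exp (- (2 * s * h)) - (1 + h * (\<bar>a\<bar> - s)) / (1 + h * (\<bar>a\<bar> + s))\<bar>
      \<le> (4 * s\<^sup>2 + 2 * s * (\<bar>a\<bar> + s)) * h * h ^ n" if "0 < h" for h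
      using exp_minus_multiplier_le_square[of s "\<bar>a\<bar>" h] s that True
      by (simp add: power2_eq_square mult.assoc)
    ultimately show ?thesis using that by blast
  next
    case False
    then have n: "a = 0" "n = 2" using n by auto
    have "0 < 2 * s ^ 3" using s by simp
    moreover have "\<bar>exp (- (2 * s * h)) - (1 + h * (\<bar>a\<bar> - s)) / (1 + h * (\<bar>a\<bar> + s))\<bar>
      \<le> 2 * s ^ 3 * h * h ^ n" if "0 < h" for h
      using exp_minus_cayley_le_cube[of "h * s"] s(1) that n
      by (simp add: power2_eq_square power3_eq_cube mult_ac)
    ultimately show ?thesis using that by blast
  qed
  define A1 where "A1 = M / (s * \<eta>)"
  define A2 where "A2 = 1 / \<eta>\<^sup>2"
  define A where "A = (2 * s / k + C)\<^sup>2 * (A1 + A2)"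
  \<comment> \<open>This is the largest step with
    \<open>h * (2 * s + \<bar>a\<bar>) \<le> 1\<close>.\<close>
  define B where "B = 1 / (2 * s + \<bar>a\<bar>)"
  have A12: "0 < A1" "0 < A2" using M s assms by (auto simp: A1_def A2_def)
  have "0 < 2 * s / k + C" using s assms by (intro add_pos_pos) auto
  then have A: "0 < A" using A12 by (auto simp: A_def)
  have B: "0 < B" using s unfolding B_def by (intro divide_pos_pos add_pos_nonneg) auto
  have "\<bar>x (real j * h) - homographic_seq k a q h e j\<bar> \<le> A * (h ^ n + \<bar>d - e\<bar>)"
    if H: "admissible_datum k a q C \<eta> d" "admissible_datum k a q C \<eta> e"
      "riccati_solution k a q d x" "0 < h" "h \<le> B" for d e x h j
  proof -
    have "h * (2 * s + \<bar>a\<bar>) \<le> 1" using H(5) s by (simp add: B_def field_simps)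
    then have "\<bar>x (real j * h) - homographic_seq k a q h e j\<bar>
        \<le> (2 * s / k + C)\<^sup>2 * (A1 * h ^ n + \<bar>d - e\<bar> / \<eta>\<^sup>2)"
      unfolding A1_def using H adm[OF H(1)] adm[OF H(2)] s M assms(1,4,5,6)
      by (intro homographic_error_bound) (auto simp: tau)
    also have "\<dots> = (2 * s / k + C)\<^sup>2 * (A1 * h ^ n + A2 * \<bar>d - e\<bar>)" by (simp add: A2_def)
    also have "\<dots> \<le> (2 * s / k + C)\<^sup>2 * ((A1 + A2) * h ^ n + (A1 + A2) * \<bar>d - e\<bar>)"
      using A12 H by (intro mult_left_mono add_mono mult_right_mono) auto
    also have "\<dots> = A * (h ^ n + \<bar>d - e\<bar>)" by (simp add: A_def algebra_simps)
    finally show ?thesis .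
  qed
  then show ?thesis using A B by blast
qed

theorem theorem1:
  fixes k q a C \<eta> :: real
  assumes "k > 0" and "q \<ge> 0" and "a\<^sup>2 + q\<^sup>2 > 0"
    and "C > 0" and "0 < \<eta>" and "\<eta> < 1 / (k * riccati_tau k a q)"
  shows
    "(\<forall>d x. d \<ge> 0 \<and> admissible_datum k a q C \<eta> d \<and> riccati_solution k a q d x \<longrightarrow>
        uniform_limit UNIV
          (\<lambda>(h, e) j. x (real j * h) - homographic_seq k a q h e j) (\<lambda>j. 0)
          (at (0, d) within
             {(h, e). h > 0 \<and> 1 + 2 * \<bar>a\<bar> * h - k * q * h\<^sup>2 \<noteq> 0 \<and>
                e > 0 \<and> admissible_datum k a q C \<eta> e})) \<and>
     (a \<noteq> 0 \<longrightarrow>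
        (\<exists>A>0. \<exists>B>0. \<forall>d e x h j.
           d \<ge> 0 \<and> admissible_datum k a q C \<eta> d \<and>
           e > 0 \<and> admissible_datum k a q C \<eta> e \<and>
           riccati_solution k a q d x \<and>
           0 < h \<and> h \<le> B \<and> 1 + 2 * \<bar>a\<bar> * h - k * q * h\<^sup>2 \<noteq> 0 \<longrightarrow>
           \<bar>x (real j * h) - homographic_seq k a q h e j\<bar> \<le> A * (h + \<bar>d - e\<bar>))) \<and>
     (a = 0 \<longrightarrow>
        (\<exists>A>0. \<exists>B>0. \<forall>d e x h j.
           d \<ge> 0 \<and> admissible_datum k a q C \<eta> d \<and>
           e > 0 \<and> admissible_datum k a q C \<eta> e \<and>
           riccati_solution k a q d x \<and>
           0 < h \<and> h \<le> B \<and> 1 + 2 * \<bar>a\<bar> * h - k * q * h\<^sup>2 \<noteq> 0 \<longrightarrow>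
           \<bar>x (real j * h) - homographic_seq k a q h e j\<bar> \<le> A * (h\<^sup>2 + \<bar>d - e\<bar>)))"
proof -
  note error = homographic_uniform_error[OF assms]
  show ?thesis
  proof (intro conjI impI allI)
    fix d x
    assume dx: "d \<ge> 0 \<and> admissible_datum k a q C \<eta> d \<and> riccati_solution k a q d x"
    define S where "S = {(h, e). h > 0 \<and> 1 + 2 * \<bar>a\<bar> * h - k * q * h\<^sup>2 \<noteq> 0 \<and>
      e > 0 \<and> admissible_datum k a q C \<eta> e}"
    \<comment> \<open>The first-order bound holds for every \<open>a\<close> and suffices for
      convergence: its right-hand side is free of \<open>j\<close> and tends to 0 at
      \<open>(0, d)\<close>.\<close>
    obtain A B where AB: "0 < A" "0 < B" "\<And>h e j. admissible_datum k a q C \<eta> e \<Longrightarrow> 0 < h \<Longrightarrow> h \<le> B \<Longrightarrow>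
      \<bar>x (real j * h) - homographic_seq k a q h e j\<bar> \<le> A * (h + \<bar>d - e\<bar>)"
      using error[of 1] dx by (metis power_one_right)
    have "uniform_limit UNIV (\<lambda>(h, e) j. x (real j * h) - homographic_seq k a q h e j) (\<lambda>j. 0)
      (at (0, d) within S)"
    proof (rule uniform_limitI)
      fix \<epsilon> :: real assume \<epsilon>: "0 < \<epsilon>"
      have "((\<lambda>p. A * (fst p + \<bar>d - snd p\<bar>)) \<longlongrightarrow> A * (fst (0, d) + \<bar>d - snd (0::real, d)\<bar>))
        (at (0, d) within S)"
        by (intro tendsto_intros tendsto_ident_at)
      then have small: "\<forall>\<^sub>F p in at (0, d) within S. A * (fst p + \<bar>d - snd p\<bar>) < \<epsilon>"
        using \<epsilon> by (intro order_tendstoD(2)) auto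
      have hB: "\<forall>\<^sub>F p in at (0, d) within S. fst p < B"
        using tendsto_fst[OF tendsto_ident_at[of "(0, d)" S]] AB(2) by (intro order_tendstoD(2)) auto
      \<comment> \<open>Membership in \<open>S\<close> supplies the positive step and the
        admissibility of \<open>e\<close> that the bound asks for.\<close>
      have inS: "\<forall>\<^sub>F p in at (0, d) within S. p \<in> S"
        by (simp add: eventually_at_filter)
      show "\<forall>\<^sub>F p in at (0, d) within S. \<forall>j\<in>UNIV.
        dist ((case p of (h, e) \<Rightarrow> \<lambda>j. x (real j * h) - homographic_seq k a q h e j) j) 0 < \<epsilon>"
        using small hB inS
      proof eventually_elim
        case (elim p)
        then show ?case using AB(3)[of "snd p" "fst p"]
          by (cases p) (fastforce simp: S_def intro: le_less_trans)
      qed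
    qed
    then show "uniform_limit UNIV (\<lambda>(h, e) j. x (real j * h) - homographic_seq k a q h e j) (\<lambda>j. 0)
      (at (0, d) within {(h, e). h > 0 \<and> 1 + 2 * \<bar>a\<bar> * h - k * q * h\<^sup>2 \<noteq> 0 \<and>
        e > 0 \<and> admissible_datum k a q C \<eta> e})"
      unfolding S_def .
  next
    assume "a \<noteq> 0"
    obtain A B where "0 < A" "0 < B" "\<forall>d e x h j. admissible_datum k a q C \<eta> d \<and>
        admissible_datum k a q C \<eta> e \<and> riccati_solution k a q d x \<and> 0 < h \<and> h \<le> B \<longrightarrow>
        \<bar>x (real j * h) - homographic_seq k a q h e j\<bar> \<le> A * (h + \<bar>d - e\<bar>)"
      using error[of 1] unfolding power_one_right by blast
    then show "\<exists>A>0. \<exists>B>0. \<forall>d e x h j.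
           d \<ge> 0 \<and> admissible_datum k a q C \<eta> d \<and>
           e > 0 \<and> admissible_datum k a q C \<eta> e \<and>
           riccati_solution k a q d x \<and>
           0 < h \<and> h \<le> B \<and> 1 + 2 * \<bar>a\<bar> * h - k * q * h\<^sup>2 \<noteq> 0 \<longrightarrow>
           \<bar>x (real j * h) - homographic_seq k a q h e j\<bar> \<le> A * (h + \<bar>d - e\<bar>)"
      by blast
  next
    assume "a = 0"
    then obtain A B where "0 < A" "0 < B" "\<forall>d e x h j. admissible_datum k a q C \<eta> d \<and>
        admissible_datum k a q C \<eta> e \<and> riccati_solution k a q d x \<and> 0 < h \<and> h \<le> B \<longrightarrow>
        \<bar>x (real j * h) - homographic_seq k a q h e j\<bar> \<le> A * (h\<^sup>2 + \<bar>d - e\<bar>)"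
      using error[of 2] by blast
    then show "\<exists>A>0. \<exists>B>0. \<forall>d e x h j.
           d \<ge> 0 \<and> admissible_datum k a q C \<eta> d \<and>
           e > 0 \<and> admissible_datum k a q C \<eta> e \<and>
           riccati_solution k a q d x \<and>
           0 < h \<and> h \<le> B \<and> 1 + 2 * \<bar>a\<bar> * h - k * q * h\<^sup>2 \<noteq> 0 \<longrightarrow>
           \<bar>x (real j * h) - homographic_seq k a q h e j\<bar> \<le> A * (h\<^sup>2 + \<bar>d - e\<bar>)"
      by blast
  qed
qed

end
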